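(* Let $s\in\{1,\dots,N_s\}$, and let $\mathcal{F}_s(\lambda_n,\rho_n^s)$ be the local ELBO and $\mathcal{L}_s(\lambda_n)$ the local LM-ELBO of sensor $s$ defined in the context, with $\rho_n^{s*}(\lambda_n)$ a parameter value such that $q_n(\theta_n^s;\rho_n^{s*}(\lambda_n))=q_n^*(\theta_n^s)$. At every $\lambda_n$ at which both Hessians below exist (i.e. $\mathcal{L}_s$, and $\mathcal{F}_s$ as a function of its first argument with second argument fixed at $\rho_n^{s*}(\lambda_n)$, are twice differentiable at $\lambda_n$), there is a positive semi-definite matrix $P$ such that $$\nabla^2_{\lambda_n}\mathcal{L}_s(\lambda_n)=\nabla^2_{\lambda_n}\mathcal{F}_s(\lambda_n,\rho_n^s)\big|_{\rho_n^s=\rho_n^{s*}(\lambda_n)}+P,$$ where $\nabla^2_{\lambda_n}\mathcal{F}_s(\lambda_n,\rho_n^s)$ is the Hessian of $\mathcal{F}_s$ considered as a function of $\lambda_n$ alone, with $\rho_n^s$ held fixed and $\rho_n^s=\rho_n^{s*}(\lambda_n)$ substituted afterwards.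
   Context: Model (fixed time step $n$). There are $K$ objects with joint state $X_n=(X_{n,1},\dots,X_{n,K})$, each $X_{n,k}$ a Euclidean vector, and $N_s$ sensors. Sensor $s$ has fixed measurements $Y_n^s=(Y_{n,1}^s,\dots,Y_{n,M_n^s}^s)$ and an unknown association vector $\theta_n^s=(\theta_{n,1}^s,\dots,\theta_{n,M_n^s}^s)\in\{0,1,\dots,K\}^{M_n^s}$. Put $\theta_n=(\theta_n^1,\dots,\theta_n^{N_s})$. The likelihood is $p(Y_n^s|\theta_n^s,X_n)=\prod_{j=1}^{M_n^s}\ell^s(Y_{n,j}^s|X_{n,\theta_{n,j}^s})$, where $\ell^s(y|X_{n,k})=\mathcal{N}(y;HX_{n,k},R_k^s)$ (Gaussian density with mean $HX_{n,k}$ and positive definite covariance $R_k^s$) for $k\ge1$, and $\ell^s(y|X_{n,0})=1/V^s$ with $V^s>0$ for $k=0$ (clutter). The association prior is $p(\theta_n^s|M_n^s)=\prod_{j}p(\theta_{n,j}^s)$ with $p(\theta_{n,j}^s=k)=\Lambda_k^s/\sum_{l=0}^K\Lambda_l^s$, where $\Lambda_k^s>0$ are Poisson rates. $\hat p_n(X_n)$ is a fixed predictive prior probability density. Variational families: $q_n(X_n;\lambda_n)=\prod_{k=1}^Kq_n(X_{n,k};\lambda_{n,k})$ with $\lambda_n=[\lambda_{n,1},\dots,\lambda_{n,K}]$ (probability densities), and $q_n(\theta_n;\rho_n)=\prod_{s=1}^{N_s}q_n(\theta_n^s;\rho_n^s)$ with $\rho_n=[\rho_n^1,\dots,\rho_n^{N_s}]$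 (probability mass functions), the parameters $\lambda_n$ and $\rho_n^s$ ranging over open subsets of Euclidean spaces. The component parameters $\rho_n^1,\dots,\rho_n^{N_s}$ range independently. Local ELBO: $$\mathcal{F}_s(\lambda_n,\rho_n^s)=\mathrm{E}_{q_n(X_n;\lambda_n)q_n(\theta_n^s;\rho_n^s)}\log p(Y_n^s|\theta_n^s,X_n)+\mathrm{E}_{q_n(\theta_n^s;\rho_n^s)}\log\frac{p(\theta_n^s|M_n^s)}{q_n(\theta_n^s;\rho_n^s)}+\frac1{N_s}\mathrm{E}_{q_n(X_n;\lambda_n)}\log\frac{\hat p_n(X_n)}{q_n(X_n;\lambda_n)}.$$ Optimal association distribution (depending on $\lambda_n$): $q_n^*(\theta_n^s)=\prod_{j=1}^{M_n^s}q_n^*(\theta_{n,j}^s)$, with $q_n^*(\theta_{n,j}^s)\propto p(\theta_{n,j}^s)\exp\big(\mathrm{E}_{q_n(X_n;\lambda_n)}\log\ell^s(Y_{n,j}^s|X_{n,\theta_{n,j}^s})\big)$. Local LM-ELBO: $$\mathcal{L}_s(\lambda_n)=\mathrm{E}_{q_n(X_n;\lambda_n)q_n^*(\theta_n^s)}\log p(Y_n^s|\theta_n^s,X_n)+\mathrm{E}_{q_n^*(\theta_n^s)}\log\frac{p(\theta_n^s|M_n^s)}{q_n^*(\theta_n^s)}+\frac1{N_s}\mathrm{E}_{q_n(X_n;\lambda_n)}\log\frac{\hat p_n(X_n)}{q_n(X_n;\lambda_n)}.$$ Standing assumptions: for every $\lambda_n$, $q_n^*(\theta_n^s)$ belongs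 to the family $\{q_n(\theta_n^s;\rho_n^s)\}$, and $\rho_n^{s*}(\lambda_n)$ denotes a parameter value with $q_n(\theta_n^s;\rho_n^{s*}(\lambda_n))=q_n^*(\theta_n^s)$. All the expectations are finite. The convention $0\log 0=0$ is used. *)

theory Defs
  imports "HOL-Analysis.Analysis"
begin

section \<open>Gradients, Hessians, positive definiteness\<close>

definition gradient :: "(real ^ 'n \<Rightarrow> real) \<Rightarrow> real ^ 'n \<Rightarrow> real ^ 'n" where
  "gradient f x = (\<chi> i. frechet_derivative f (at x) (axis i 1))"

definition twice_differentiable_at :: "(real ^ 'n \<Rightarrow> real) \<Rightarrow> real ^ 'n \<Rightarrow> bool" where
  "twice_differentiable_at f x \<longleftrightarrow>
     (\<forall>\<^sub>F y in nhds x. f differentiable (at y)) \<and> gradient f differentiable (at x)"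

definition hessian :: "(real ^ 'n \<Rightarrow> real) \<Rightarrow> real ^ 'n \<Rightarrow> real ^ 'n ^ 'n" where
  "hessian f x = jacobian (gradient f) (at x)"

definition positive_semidefinite :: "real ^ 'n ^ 'n \<Rightarrow> bool" where
  "positive_semidefinite A \<longleftrightarrow> transpose A = A \<and> (\<forall>v. 0 \<le> v \<bullet> (A *v v))"

definition positive_definite :: "real ^ 'n ^ 'n \<Rightarrow> bool" where
  "positive_definite A \<longleftrightarrow> transpose A = A \<and> (\<forall>v. v \<noteq> 0 \<longrightarrow> 0 < v \<bullet> (A *v v))"

section \<open>Probability densities\<close>

definition probability_density :: "'a measure \<Rightarrow> ('a \<Rightarrow> real) \<Rightarrow> bool" where
  "probability_density M f \<longleftrightarrow>
     f \<in> borel_measurable M \<and> (\<forall>x\<in>space M. 0 \<le> f x) \<and> (\<integral>\<^sup>+ x. ennreal (f x) \<partial>M) = 1"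

text \<open>Density at \<open>y\<close> of the multivariate normal distribution with mean \<open>\<mu>\<close> and covariance \<open>R\<close>.\<close>

definition gaussian_density :: "real ^ 'm \<Rightarrow> real ^ 'm \<Rightarrow> real ^ 'm ^ 'm \<Rightarrow> real" where
  "gaussian_density y \<mu> R =
     exp (- (1 / 2) * ((y - \<mu>) \<bullet> (matrix_inv R *v (y - \<mu>))))
       / sqrt ((2 * pi) ^ CARD('m) * det R)"

section \<open>Multi-sensor multi-object model at a fixed time step\<close>

text \<open>
  Objects are \<open>1, \<dots>, n_obj\<close> and \<open>0\<close> stands for clutter; sensors are \<open>1, \<dots>, n_sens\<close>; the
  measurements of sensor \<open>s\<close> are \<open>meas s 1, \<dots>, meas s (n_meas s)\<close>. Joint states are families
  \<open>X\<close> in the product space over \<open>{1..n_obj}\<close>.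
\<close>

record ('d::finite, 'm::finite) tracking_model =
  n_obj :: nat
  n_sens :: nat
  n_meas :: "nat \<Rightarrow> nat"
  meas :: "nat \<Rightarrow> nat \<Rightarrow> real ^ 'm"
  obs_matrix :: "real ^ 'd ^ 'm"
  noise_cov :: "nat \<Rightarrow> nat \<Rightarrow> real ^ 'm ^ 'm"  \<comment> \<open>sensor, object\<close>
  volume :: "nat \<Rightarrow> real"
  rate :: "nat \<Rightarrow> nat \<Rightarrow> real"  \<comment> \<open>sensor, object or clutter\<close>
  predictive_prior :: "(nat \<Rightarrow> real ^ 'd) \<Rightarrow> real"

definition state_space :: "('d::finite, 'm::finite) tracking_model \<Rightarrow> (nat \<Rightarrow> real ^ 'd) measure" where
  "state_space Md = PiM {1..n_obj Md} (\<lambda>_. lborel)"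

definition associations :: "('d::finite, 'm::finite) tracking_model \<Rightarrow> nat \<Rightarrow> (nat \<Rightarrow> nat) set" where
  "associations Md s = {1..n_meas Md s} \<rightarrow>\<^sub>E {0..n_obj Md}"

definition valid_model :: "('d::finite, 'm::finite) tracking_model \<Rightarrow> bool" where
  "valid_model Md \<longleftrightarrow>
     1 \<le> n_obj Md \<and>
     (\<forall>s\<in>{1..n_sens Md}. 0 < volume Md s \<and>
        (\<forall>k\<in>{1..n_obj Md}. positive_definite (noise_cov Md s k)) \<and>
        (\<forall>k\<in>{0..n_obj Md}. 0 < rate Md s k)) \<and>
     probability_density (state_space Md) (predictive_prior Md)"

text \<open>\<open>meas_lik Md s y k X\<close> is \<open>\<ell>\<^sup>s(y | X\<^sub>k)\<close>.\<close>

definition meas_lik ::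
  "('d::finite, 'm::finite) tracking_model \<Rightarrow> nat \<Rightarrow> real ^ 'm \<Rightarrow> nat \<Rightarrow> (nat \<Rightarrow> real ^ 'd) \<Rightarrow> real" where
  "meas_lik Md s y k X =
     (if k = 0 then 1 / volume Md s
      else gaussian_density y (obs_matrix Md *v X k) (noise_cov Md s k))"

definition likelihood ::
  "('d::finite, 'm::finite) tracking_model \<Rightarrow> nat \<Rightarrow> (nat \<Rightarrow> nat) \<Rightarrow> (nat \<Rightarrow> real ^ 'd) \<Rightarrow> real" where
  "likelihood Md s \<theta> X = (\<Prod>j=1..n_meas Md s. meas_lik Md s (meas Md s j) (\<theta> j) X)"

definition assoc_prior1 :: "('d::finite, 'm::finite) tracking_model \<Rightarrow> nat \<Rightarrow> nat \<Rightarrow> real" where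
  "assoc_prior1 Md s k = rate Md s k / (\<Sum>l=0..n_obj Md. rate Md s l)"

definition assoc_prior :: "('d::finite, 'm::finite) tracking_model \<Rightarrow> nat \<Rightarrow> (nat \<Rightarrow> nat) \<Rightarrow> real" where
  "assoc_prior Md s \<theta> = (\<Prod>j=1..n_meas Md s. assoc_prior1 Md s (\<theta> j))"

section \<open>Variational families\<close>

text \<open>
  The parameter \<open>\<lambda>\<close> is the concatenation of the \<open>\<lambda>\<^sub>k\<close>, whose dimensions may differ: \<open>owner i\<close> is
  the object to whose parameter the coordinate \<open>i\<close> belongs, and \<open>\<lambda>\<^sub>k\<close> is represented by \<open>\<lambda>\<close> with
  the coordinates of all other objects set to zero. The parameter \<open>\<rho>\<^sup>s\<close> lives in the Euclidean
  space of dimension \<open>rho_dim s\<close>, represented by sequences vanishing from that index on.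
\<close>

record ('d::finite, 'p::finite) variational_family =
  lambda_dom :: "(real ^ 'p) set"
  owner :: "'p \<Rightarrow> nat"
  state_factor :: "nat \<Rightarrow> real ^ 'p \<Rightarrow> real ^ 'd \<Rightarrow> real"
  rho_dim :: "nat \<Rightarrow> nat"
  rho_dom :: "nat \<Rightarrow> (nat \<Rightarrow> real) set"
  assoc_pmf :: "nat \<Rightarrow> (nat \<Rightarrow> real) \<Rightarrow> (nat \<Rightarrow> nat) \<Rightarrow> real"

definition lambda_part :: "('d::finite, 'p::finite) variational_family \<Rightarrow> nat \<Rightarrow> real ^ 'p \<Rightarrow> real ^ 'p" where
  "lambda_part Q k lam = (\<chi> i. if owner Q i = k then lam $ i else 0)"

definition q_state ::
  "('d::finite, 'm::finite) tracking_model \<Rightarrow> ('d::finite, 'p::finite) variational_family \<Rightarrow> real ^ 'p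
     \<Rightarrow> (nat \<Rightarrow> real ^ 'd) \<Rightarrow> real" where
  "q_state Md Q lam X = (\<Prod>k=1..n_obj Md. state_factor Q k (lambda_part Q k lam) (X k))"

definition valid_family ::
  "('d::finite, 'm::finite) tracking_model \<Rightarrow> ('d::finite, 'p::finite) variational_family \<Rightarrow> bool" where
  "valid_family Md Q \<longleftrightarrow>
     open (lambda_dom Q) \<and> range (owner Q) \<subseteq> {1..n_obj Md} \<and>
     (\<forall>lam\<in>lambda_dom Q. \<forall>k\<in>{1..n_obj Md}.
        probability_density lborel (state_factor Q k (lambda_part Q k lam))) \<and>
     (\<forall>s\<in>{1..n_sens Md}.
        openin (Euclidean_space (rho_dim Q s)) (rho_dom Q s) \<and>
        (\<forall>\<rho>\<in>rho_dom Q s.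
           (\<forall>\<theta>\<in>associations Md s. 0 \<le> assoc_pmf Q s \<rho> \<theta>) \<and>
           (\<Sum>\<theta>\<in>associations Md s. assoc_pmf Q s \<rho> \<theta>) = 1))"

section \<open>Expectations and evidence lower bounds\<close>

definition E_state ::
  "('d::finite, 'm::finite) tracking_model \<Rightarrow> ('d::finite, 'p::finite) variational_family \<Rightarrow> real ^ 'p
     \<Rightarrow> ((nat \<Rightarrow> real ^ 'd) \<Rightarrow> real) \<Rightarrow> real" where
  "E_state Md Q lam f = (\<integral>X. q_state Md Q lam X * f X \<partial>state_space Md)"

definition E_assoc ::
  "('d::finite, 'm::finite) tracking_model \<Rightarrow> nat \<Rightarrow> ((nat \<Rightarrow> nat) \<Rightarrow> real) \<Rightarrow> ((nat \<Rightarrow> nat) \<Rightarrow> real) \<Rightarrow> real" where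
  "E_assoc Md s q g = (\<Sum>\<theta>\<in>associations Md s. q \<theta> * g \<theta>)"

definition E_joint ::
  "('d::finite, 'm::finite) tracking_model \<Rightarrow> ('d::finite, 'p::finite) variational_family \<Rightarrow> nat \<Rightarrow> real ^ 'p
     \<Rightarrow> ((nat \<Rightarrow> nat) \<Rightarrow> real) \<Rightarrow> ((nat \<Rightarrow> nat) \<Rightarrow> (nat \<Rightarrow> real ^ 'd) \<Rightarrow> real) \<Rightarrow> real" where
  "E_joint Md Q s lam q f = E_assoc Md s q (\<lambda>\<theta>. E_state Md Q lam (f \<theta>))"

text \<open>
  Finiteness of all expectations. Since \<open>ln 0 = 0\<close> in HOL, finiteness of the third term of the
  bounds also needs the prior to be positive almost everywhere where \<open>q\<close> is; the convention
  \<open>0 log 0 = 0\<close> is automatic.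
\<close>

definition finite_expectations ::
  "('d::finite, 'm::finite) tracking_model \<Rightarrow> ('d::finite, 'p::finite) variational_family \<Rightarrow> bool" where
  "finite_expectations Md Q \<longleftrightarrow>
     (\<forall>lam\<in>lambda_dom Q.
        (\<forall>s\<in>{1..n_sens Md}. \<forall>j\<in>{1..n_meas Md s}. \<forall>k\<in>{0..n_obj Md}.
           integrable (state_space Md)
             (\<lambda>X. q_state Md Q lam X * ln (meas_lik Md s (meas Md s j) k X))) \<and>
        (AE X in state_space Md. 0 < q_state Md Q lam X \<longrightarrow> 0 < predictive_prior Md X) \<and>
        integrable (state_space Md)
          (\<lambda>X. q_state Md Q lam X * ln (predictive_prior Md X / q_state Md Q lam X)))"

definition q_opt_weight ::
  "('d::finite, 'm::finite) tracking_model \<Rightarrow> ('d::finite, 'p::finite) variational_family \<Rightarrow> nat \<Rightarrow> real ^ 'p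
     \<Rightarrow> nat \<Rightarrow> nat \<Rightarrow> real" where
  "q_opt_weight Md Q s lam j k =
     assoc_prior1 Md s k * exp (E_state Md Q lam (\<lambda>X. ln (meas_lik Md s (meas Md s j) k X)))"

definition q_opt1 ::
  "('d::finite, 'm::finite) tracking_model \<Rightarrow> ('d::finite, 'p::finite) variational_family \<Rightarrow> nat \<Rightarrow> real ^ 'p
     \<Rightarrow> nat \<Rightarrow> nat \<Rightarrow> real" where
  "q_opt1 Md Q s lam j k =
     q_opt_weight Md Q s lam j k / (\<Sum>l=0..n_obj Md. q_opt_weight Md Q s lam j l)"

definition q_opt ::
  "('d::finite, 'm::finite) tracking_model \<Rightarrow> ('d::finite, 'p::finite) variational_family \<Rightarrow> nat \<Rightarrow> real ^ 'p
     \<Rightarrow> (nat \<Rightarrow> nat) \<Rightarrow> real" where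
  "q_opt Md Q s lam \<theta> = (\<Prod>j=1..n_meas Md s. q_opt1 Md Q s lam j (\<theta> j))"

definition local_elbo ::
  "('d::finite, 'm::finite) tracking_model \<Rightarrow> ('d::finite, 'p::finite) variational_family \<Rightarrow> nat \<Rightarrow> real ^ 'p
     \<Rightarrow> (nat \<Rightarrow> real) \<Rightarrow> real" where
  "local_elbo Md Q s lam \<rho> =
     E_joint Md Q s lam (assoc_pmf Q s \<rho>) (\<lambda>\<theta> X. ln (likelihood Md s \<theta> X))
     + E_assoc Md s (assoc_pmf Q s \<rho>) (\<lambda>\<theta>. ln (assoc_prior Md s \<theta> / assoc_pmf Q s \<rho> \<theta>))
     + 1 / real (n_sens Md)
         * E_state Md Q lam (\<lambda>X. ln (predictive_prior Md X / q_state Md Q lam X))"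

definition local_lm_elbo ::
  "('d::finite, 'm::finite) tracking_model \<Rightarrow> ('d::finite, 'p::finite) variational_family \<Rightarrow> nat \<Rightarrow> real ^ 'p \<Rightarrow> real" where
  "local_lm_elbo Md Q s lam =
     E_joint Md Q s lam (q_opt Md Q s lam) (\<lambda>\<theta> X. ln (likelihood Md s \<theta> X))
     + E_assoc Md s (q_opt Md Q s lam) (\<lambda>\<theta>. ln (assoc_prior Md s \<theta> / q_opt Md Q s lam \<theta>))
     + 1 / real (n_sens Md)
         * E_state Md Q lam (\<lambda>X. ln (predictive_prior Md X / q_state Md Q lam X))"

definition is_opt_parameter ::
  "('d::finite, 'm::finite) tracking_model \<Rightarrow> ('d::finite, 'p::finite) variational_family \<Rightarrow> nat \<Rightarrow> real ^ 'p
     \<Rightarrow> (nat \<Rightarrow> real) \<Rightarrow> bool" where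
  "is_opt_parameter Md Q s lam \<rho> \<longleftrightarrow>
     \<rho> \<in> rho_dom Q s \<and> (\<forall>\<theta>\<in>associations Md s. assoc_pmf Q s \<rho> \<theta> = q_opt Md Q s lam \<theta>)"

end

theory Submission
  imports Defs
begin

text \<open>
  By Gibbs' inequality the optimal association distribution maximises the local ELBO over all
  association distributions, so \<open>\<lambda> \<mapsto> \<L>\<^sub>s(\<lambda>) - \<F>\<^sub>s(\<lambda>, \<rho>)\<close> is nonnegative for every fixed \<open>\<rho>\<close>, and it
  vanishes at \<open>\<lambda>\<^sub>0\<close> when \<open>\<rho> = \<rho>\<^sup>*(\<lambda>\<^sub>0)\<close>. Hence \<open>\<lambda>\<^sub>0\<close> is a minimum of this difference, whose Hessian
  there is the required \<open>P\<close>.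
\<close>

section \<open>Second-order differentiability at a point\<close>

text \<open>\<open>gradient\<close> records only the values of the derivative on the axes; expanding
  \<open>h\<close> in the standard basis recovers the whole derivative by linearity.\<close>

lemma has_derivative_gradient:
  fixes f :: "real ^ 'n \<Rightarrow> real"
  assumes "f differentiable (at x)"
  shows "(f has_derivative (\<lambda>h. gradient f x \<bullet> h)) (at x)"
proof -
  have lin: "linear (frechet_derivative f (at x))"
    using assms by (rule linear_frechet_derivative)
  have "frechet_derivative f (at x) h = gradient f x \<bullet> h" for h
  proof -
    have "frechet_derivative f (at x) h = frechet_derivative f (at x) (\<Sum>i\<in>UNIV. h $ i *\<^sub>R axis i 1)"
      using basis_expansion[of h] by (simp add: scalar_mult_eq_scaleR)
    also have "\<dots> = (\<Sum>i\<in>UNIV. h $ i * frechet_derivative f (at x) (axis i 1))"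
      using lin by (simp add: linear_sum linear_cmul)
    also have "\<dots> = gradient f x \<bullet> h"
      by (simp add: gradient_def inner_vec_def mult.commute)
    finally show ?thesis .
  qed
  then show ?thesis
    using assms unfolding frechet_derivative_works by presburger
qed

lemma gradient_eqI:
  fixes f :: "real ^ 'n \<Rightarrow> real"
  assumes "(f has_derivative (\<lambda>h. a \<bullet> h)) (at x)"
  shows "gradient f x = a"
  using frechet_derivative_at[OF assms, symmetric]
  by (simp add: gradient_def vec_eq_iff inner_axis)

lemma has_derivative_hessian:
  assumes "twice_differentiable_at f x"
  shows "(gradient f has_derivative (\<lambda>h. hessian f x *v h)) (at x)"
  using assms unfolding twice_differentiable_at_def hessian_def jacobian_works by simp

lemma hessian_eqI:
  assumes "(gradient f has_derivative (\<lambda>h. A *v h)) (at x)"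
  shows "hessian f x = A"
  using frechet_derivative_at[OF assms, symmetric]
  by (simp add: hessian_def jacobian_def)

lemma twice_differentiable_at_ball:
  assumes "twice_differentiable_at f x"
  obtains r where "r > 0"
    and "\<And>y. dist y x < r \<Longrightarrow> (f has_derivative (\<lambda>h. gradient f y \<bullet> h)) (at y)"
  using assms has_derivative_gradient
  unfolding twice_differentiable_at_def eventually_nhds_metric by metis

text \<open>The rule for differences of gradients holds only where both functions are
  differentiable, which is guaranteed just near \<open>x\<close>. That is enough, since a derivative
  at \<open>x\<close> depends only on values in an open set \<open>S\<close> around it.\<close>

lemma
  assumes f: "twice_differentiable_at f x" and g: "twice_differentiable_at g x"
  shows twice_differentiable_at_diff: "twice_differentiable_at (\<lambda>y. f y - g y) x" (is ?twice)
    and hessian_diff: "hessian (\<lambda>y. f y - g y) x = hessian f x - hessian g x" (is ?hess)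
proof -
  have ev: "\<forall>\<^sub>F y in nhds x. f differentiable (at y) \<and> g differentiable (at y)"
    using f g by (simp add: twice_differentiable_at_def eventually_conj_iff)
  have "\<forall>\<^sub>F y in nhds x. gradient f y - gradient g y = gradient (\<lambda>y. f y - g y) y"
    using ev
  proof eventually_elim
    case (elim y)
    have "((\<lambda>y. f y - g y) has_derivative (\<lambda>h. (gradient f y - gradient g y) \<bullet> h)) (at y)"
      using elim by (auto intro!: derivative_eq_intros has_derivative_gradient simp: inner_diff_left)
    then show ?case by (simp add: gradient_eqI)
  qed
  then obtain S where S: "open S" "x \<in> S"
      "\<And>y. y \<in> S \<Longrightarrow> gradient f y - gradient g y = gradient (\<lambda>y. f y - g y) y"
    unfolding eventually_nhds by blast
  have "((\<lambda>y. gradient f y - gradient g y) has_derivative (\<lambda>h. (hessian f x - hessian g x) *v h)) (at x)"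
    using has_derivative_hessian[OF f] has_derivative_hessian[OF g]
    by (auto intro!: derivative_eq_intros simp: matrix_vector_mult_diff_rdistrib)
  from has_derivative_transform_within_open[OF this S]
  have der: "(gradient (\<lambda>y. f y - g y) has_derivative (\<lambda>h. (hessian f x - hessian g x) *v h)) (at x)" .
  then show ?hess by (rule hessian_eqI)
  have "\<forall>\<^sub>F y in nhds x. (\<lambda>y. f y - g y) differentiable (at y)"
    using ev by eventually_elim (simp add: differentiable_diff)
  with der show ?twice
    unfolding twice_differentiable_at_def differentiable_def by blast
qed

section \<open>Symmetry of the Hessian\<close>

text \<open>
  The second difference is symmetric in \<open>u\<close> and \<open>v\<close>, which gives the symmetry of the Hessian
  without continuity of the second derivative.
\<close>

lemma second_difference_tendsto:
  fixes f :: "real ^ 'n \<Rightarrow> real"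
  assumes f: "twice_differentiable_at f x"
  shows "((\<lambda>t. (f (x + t *\<^sub>R u + t *\<^sub>R v) - f (x + t *\<^sub>R u) - f (x + t *\<^sub>R v) + f x) / t\<^sup>2)
           \<longlongrightarrow> u \<bullet> (hessian f x *v v)) (at_right 0)"
    (is "((\<lambda>t. ?D t / t\<^sup>2) \<longlongrightarrow> u \<bullet> (?A *v v)) _")
proof (rule tendstoI)
  fix e :: real assume e: "e > 0"
  \<comment> \<open>\<open>t * K\<close> bounds every displacement used below; the summand 1 keeps
    \<open>K\<close> positive even if \<open>u\<close> and \<open>v\<close> vanish.\<close>
  define K where "K = norm u + norm v + 1"
  have K: "K \<ge> 1" "norm u \<le> K" "norm u + norm v \<le> K" by (auto simp: K_def)
  obtain r where r: "r > 0"
    and grad: "\<And>y. dist y x < r \<Longrightarrow> (f has_derivative (\<lambda>h. gradient f y \<bullet> h)) (at y)"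
    using twice_differentiable_at_ball[OF f] by blast
  \<comment> \<open>Two remainders, each at most \<open>e' * (t * K)\<close>, are paired with
    \<open>u\<close> and divided by \<open>t\<close>; the total \<open>2 * e' * K\<^sup>2\<close> is
    then \<open>e / 2\<close>.\<close>
  define e' where "e' = e / (4 * K\<^sup>2)"
  have e': "e' > 0" using e K by (simp add: e'_def)
  obtain d where d: "d > 0"
    and lin: "\<And>y. norm (y - x) < d \<Longrightarrow>
      norm (gradient f y - gradient f x - ?A *v (y - x)) \<le> e' * norm (y - x)"
    using has_derivative_hessian[OF f] e' unfolding has_derivative_at_alt by blast
  define \<delta> where "\<delta> = min r d / K"
  have "\<delta> > 0" using r d K by (simp add: \<delta>_def)
  have bound: "dist (?D t / t\<^sup>2) (u \<bullet> (?A *v v)) < e" if t: "0 < t" "t < \<delta>" for t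
  proof -
    have tK: "t * K < r" "t * K < d" using t K by (auto simp: \<delta>_def pos_less_divide_eq)
    \<comment> \<open>All points of the parallelogram spanned by \<open>t *\<^sub>R u\<close> and
      \<open>t *\<^sub>R v\<close> stay in both balls around \<open>x\<close>.\<close>
    have near: "norm (a *\<^sub>R u + b *\<^sub>R v) \<le> t * K" if "0 \<le> a" "a \<le> t" "0 \<le> b" "b \<le> t" for a b
    proof -
      have "norm (a *\<^sub>R u + b *\<^sub>R v) \<le> a * norm u + b * norm v"
        using norm_triangle_ineq[of "a *\<^sub>R u" "b *\<^sub>R v"] that by simp
      also have "\<dots> \<le> t * norm u + t * norm v"
        using that by (intro add_mono mult_right_mono) auto
      also have "\<dots> \<le> t * K"
        using t K by (simp flip: distrib_left)
      finally show ?thesis .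
    qed
    \<comment> \<open>The second difference is the increment over \<open>[0, t]\<close> of the first
      difference in direction \<open>v\<close>. Applying the mean value theorem to \<phi> as a whole
      yields one \<tau> common to both gradients.\<close>
    define \<phi> where "\<phi> \<tau> = f (x + \<tau> *\<^sub>R u + t *\<^sub>R v) - f (x + \<tau> *\<^sub>R u)" for \<tau>
    have D: "?D t = \<phi> t - \<phi> 0" by (simp add: \<phi>_def)
    have der: "(\<phi> has_real_derivative
        (gradient f (x + \<tau> *\<^sub>R u + t *\<^sub>R v) - gradient f (x + \<tau> *\<^sub>R u)) \<bullet> u) (at \<tau>)"
      if "0 \<le> \<tau>" "\<tau> \<le> t" for \<tau>
    proof -
      have 1: "dist (x + \<tau> *\<^sub>R u + t *\<^sub>R v) x < r" "dist (x + \<tau> *\<^sub>R u) x < r"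
        using near[of \<tau> t] near[of \<tau> 0] that t tK by (auto simp: dist_norm add.assoc)
      have 2: "((\<lambda>\<tau>. x + \<tau> *\<^sub>R u + t *\<^sub>R v) has_derivative (\<lambda>h. h *\<^sub>R u)) (at \<tau>)"
        "((\<lambda>\<tau>. x + \<tau> *\<^sub>R u) has_derivative (\<lambda>h. h *\<^sub>R u)) (at \<tau>)"
        by (auto intro!: derivative_eq_intros)
      show ?thesis
        unfolding has_field_derivative_def \<phi>_def
        by (rule has_derivative_eq_rhs, rule has_derivative_diff,
            rule has_derivative_compose[OF 2(1) grad[OF 1(1)]],
            rule has_derivative_compose[OF 2(2) grad[OF 1(2)]])
          (auto simp: algebra_simps)
    qed
    obtain \<tau> where \<tau>: "0 < \<tau>" "\<tau> < t"
      and mvt: "\<phi> t - \<phi> 0 =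
        (t - 0) * ((gradient f (x + \<tau> *\<^sub>R u + t *\<^sub>R v) - gradient f (x + \<tau> *\<^sub>R u)) \<bullet> u)"
      using MVT2[OF t(1) der] by blast
    define p q where "p = x + \<tau> *\<^sub>R u + t *\<^sub>R v" and "q = x + \<tau> *\<^sub>R u"
    \<comment> \<open>These are the errors of the linear approximation of the gradient around
      \<open>x\<close>. In the difference \<open>gradient f x\<close> cancels, and
      \<open>p - q = t *\<^sub>R v\<close> leaves the Hessian term.\<close>
    define rp rq where "rp = gradient f p - gradient f x - ?A *v (p - x)"
      and "rq = gradient f q - gradient f x - ?A *v (q - x)"
    have npq: "norm (p - x) \<le> t * K" "norm (q - x) \<le> t * K"
      using near[of \<tau> t] near[of \<tau> 0] \<tau> by (auto simp: p_def q_def add.assoc)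
    have "norm rp \<le> e' * (t * K)" "norm rq \<le> e' * (t * K)"
      using lin[of p] lin[of q] npq tK mult_left_mono[OF npq(1), of e'] mult_left_mono[OF npq(2), of e'] e'
      unfolding rp_def rq_def by linarith+
    then have rem: "norm (rp - rq) \<le> 2 * (e' * (t * K))"
      using norm_triangle_ineq4[of rp rq] by linarith
    have "gradient f p - gradient f q = (rp - rq) + (?A *v (p - x) - ?A *v (q - x))"
      by (simp add: rp_def rq_def)
    also have "?A *v (p - x) - ?A *v (q - x) = t *\<^sub>R (?A *v v)"
      by (simp add: p_def q_def flip: matrix_vector_mult_diff_distrib)
        (simp add: matrix_vector_mult_scaleR)
    finally have "(gradient f p - gradient f q) \<bullet> u = (rp - rq) \<bullet> u + t * (u \<bullet> (?A *v v))"
      by (simp only: inner_add_left inner_scaleR_left inner_commute[of u])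
    then have "?D t = t * ((rp - rq) \<bullet> u) + t\<^sup>2 * (u \<bullet> (?A *v v))"
      unfolding D mvt p_def[symmetric] unfolding q_def[symmetric]
      by (simp add: power2_eq_square distrib_left)
    \<comment> \<open>The mean value theorem supplied one factor \<open>t\<close>; the remaining
      \<open>1 / t\<close> is absorbed by the bound on \<open>rp - rq\<close>, which is linear in
      \<open>t\<close>.\<close>
    then have "\<bar>?D t / t\<^sup>2 - u \<bullet> (?A *v v)\<bar> = \<bar>(rp - rq) \<bullet> u\<bar> / t"
      using t by (simp add: field_simps power2_eq_square abs_mult)
    also have "\<dots> \<le> (norm (rp - rq) * norm u) / t"
      using t by (intro divide_right_mono Cauchy_Schwarz_ineq2) auto
    also have "\<dots> \<le> (2 * (e' * (t * K)) * K) / t"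
      using t K rem e' by (intro divide_right_mono mult_mono) auto
    also have "\<dots> = e / 2"
      using t K by (simp add: e'_def power2_eq_square)
    also have "\<dots> < e" using e by simp
    finally show ?thesis by (simp add: dist_real_def)
  qed
  show "\<forall>\<^sub>F t in at_right 0. dist (?D t / t\<^sup>2) (u \<bullet> (?A *v v)) < e"
    unfolding eventually_at_right_field using \<open>\<delta> > 0\<close> bound by blast
qed

lemma transpose_hessian:
  assumes "twice_differentiable_at f x"
  shows "transpose (hessian f x) = hessian f x"
proof -
  have "u \<bullet> (hessian f x *v v) = v \<bullet> (hessian f x *v u)" for u v
  proof (rule tendsto_unique[OF _ second_difference_tendsto[OF assms]])
    show "((\<lambda>t. (f (x + t *\<^sub>R u + t *\<^sub>R v) - f (x + t *\<^sub>R u) - f (x + t *\<^sub>R v) + f x) / t\<^sup>2)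
        \<longlongrightarrow> v \<bullet> (hessian f x *v u)) (at_right 0)"
      using second_difference_tendsto[OF assms, of v u] by (simp add: algebra_simps)
  qed simp
  then have "(transpose (hessian f x) *v u) \<bullet> v = (hessian f x *v u) \<bullet> v" for u v
    by (metis dot_lmul_matrix inner_commute transpose_matrix_vector)
  then show ?thesis
    by (metis matrix_eq vector_eq_rdot)
qed

section \<open>Second-order necessary condition at a local minimum\<close>

text \<open>Were the quadratic form negative in a direction \<open>v\<close>, the directional
  derivative, zero at \<open>x\<close>, would turn negative just beyond it along \<open>v\<close>.
  By the mean value theorem \<open>f\<close> would fall below \<open>f x\<close>. No Taylor
  expansion is involved.\<close>

lemma positive_semidefinite_hessian_local_min:
  fixes f :: "real ^ 'n \<Rightarrow> real"
  assumes f: "twice_differentiable_at f x" and min: "\<forall>\<^sub>F y in nhds x. f x \<le> f y"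
  shows "positive_semidefinite (hessian f x)"
  unfolding positive_semidefinite_def
proof (intro conjI allI)
  show "transpose (hessian f x) = hessian f x" using f by (rule transpose_hessian)
  fix v
  show "0 \<le> v \<bullet> (hessian f x *v v)"
  proof (rule ccontr)
    assume neg: "\<not> 0 \<le> v \<bullet> (hessian f x *v v)"
    obtain r where r: "r > 0"
      and grad: "\<And>y. dist y x < r \<Longrightarrow> (f has_derivative (\<lambda>h. gradient f y \<bullet> h)) (at y)"
      using twice_differentiable_at_ball[OF f] by blast
    obtain m where m: "m > 0" "\<And>y. dist y x < m \<Longrightarrow> f x \<le> f y"
      using min unfolding eventually_nhds_metric by blast
    have "(\<lambda>h. gradient f x \<bullet> h) = (\<lambda>h. 0)"
      using grad[of x] r min
      by (intro has_derivative_local_min[where f = f and x = x])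
        (auto simp: eventually_at_filter elim: eventually_mono)
    then have crit: "gradient f x \<bullet> v = 0" by metis
    have line: "((\<lambda>t. x + t *\<^sub>R v) has_derivative (\<lambda>h. h *\<^sub>R v)) (at t)" for t
      by (auto intro!: derivative_eq_intros)
    \<comment> \<open>The base point is written \<open>x + 0 *\<^sub>R v\<close> so that the chain
      rule along the line matches at parameter 0.\<close>
    have "(gradient f has_derivative (\<lambda>h. hessian f x *v h)) (at (x + 0 *\<^sub>R v))"
      using has_derivative_hessian[OF f] by simp
    then have "((\<lambda>t. gradient f (x + t *\<^sub>R v)) has_derivative (\<lambda>h. hessian f x *v (h *\<^sub>R v))) (at 0)"
      by (rule has_derivative_compose[OF line])
    then have "((\<lambda>t. gradient f (x + t *\<^sub>R v) \<bullet> v) has_derivative (\<lambda>h. (hessian f x *v (h *\<^sub>R v)) \<bullet> v)) (at 0)"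
      by (rule has_derivative_inner_left)
    then have "((\<lambda>t. gradient f (x + t *\<^sub>R v) \<bullet> v) has_real_derivative v \<bullet> (hessian f x *v v)) (at 0)"
      unfolding has_field_derivative_def
      by (rule has_derivative_eq_rhs) (auto simp: matrix_vector_mult_scaleR inner_commute)
    from DERIV_neg_dec_right[OF this] neg crit obtain d where d: "d > 0"
      and dec: "\<And>t. 0 < t \<Longrightarrow> t < d \<Longrightarrow> gradient f (x + t *\<^sub>R v) \<bullet> v < 0"
      by (auto simp: not_le)
    \<comment> \<open>The step \<open>t\<close> must keep the slope negative (\<open>d\<close>),
      \<open>f\<close> differentiable (\<open>r\<close>) and the minimum inequality valid
      (\<open>m\<close>).\<close>
    have "0 < min d (min r m / (norm v + 1))"
      using d r m(1) by (simp add: add_nonneg_pos)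
    then obtain t where "0 < t" "t < min d (min r m / (norm v + 1))"
      using dense by blast
    then have t: "0 < t" "t < d" "t < min r m / (norm v + 1)"
      by simp_all
    have "t * (norm v + 1) < min r m"
      using t(3) by (simp add: pos_less_divide_eq add_nonneg_pos)
    then have tv: "t * norm v < r" "t * norm v < m"
      using t(1) by (auto simp: algebra_simps)
    have der: "((\<lambda>t. f (x + t *\<^sub>R v)) has_real_derivative gradient f (x + \<tau> *\<^sub>R v) \<bullet> v) (at \<tau>)"
      if "0 \<le> \<tau>" "\<tau> \<le> t" for \<tau>
    proof -
      have "\<tau> * norm v \<le> t * norm v" using that by (intro mult_right_mono) auto
      then have "dist (x + \<tau> *\<^sub>R v) x < r" using tv that by (simp add: dist_norm)
      from has_derivative_compose[OF line grad[OF this]] show ?thesis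
        unfolding has_field_derivative_def
        by (rule has_derivative_eq_rhs) (auto simp: mult.commute)
    qed
    obtain \<tau> where \<tau>: "0 < \<tau>" "\<tau> < t"
      and "f (x + t *\<^sub>R v) - f (x + 0 *\<^sub>R v) = (t - 0) * (gradient f (x + \<tau> *\<^sub>R v) \<bullet> v)"
      using MVT2[OF t(1) der] by blast
    moreover have "t * (gradient f (x + \<tau> *\<^sub>R v) \<bullet> v) < 0"
      using dec[of \<tau>] \<tau> t by (intro mult_pos_neg) auto
    moreover have "f x \<le> f (x + t *\<^sub>R v)"
      using m(2)[of "x + t *\<^sub>R v"] tv t by (simp add: dist_norm)
    ultimately show False by simp
  qed
qed

section \<open>Optimality of the association distribution\<close>

text \<open>The bound \<open>ln z \<le> z - 1\<close> at \<open>z = p x / q x\<close> gives an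
  estimate by \<open>p x - q x\<close>, which sums to zero. Zeros of \<open>q\<close> are harmless,
  but \<open>p\<close> must be positive: with \<open>ln 0 = 0\<close>, a zero of \<open>p\<close>
  would cost nothing on the left.\<close>

lemma Gibbs_inequality:
  fixes p q :: "'a \<Rightarrow> real"
  assumes "\<And>x. x \<in> A \<Longrightarrow> 0 < p x" "\<And>x. x \<in> A \<Longrightarrow> 0 \<le> q x" "sum p A = sum q A"
  shows "(\<Sum>x\<in>A. q x * ln (p x)) \<le> (\<Sum>x\<in>A. q x * ln (q x))"
proof -
  have "q x * ln (p x) - q x * ln (q x) \<le> p x - q x" if x: "x \<in> A" for x
  proof (cases "q x = 0")
    case False
    with assms(2)[OF x] have q: "0 < q x" by simp
    have "q x * ln (p x) - q x * ln (q x) = q x * ln (p x / q x)"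
      using q assms(1)[OF x] by (simp add: ln_div algebra_simps)
    also have "\<dots> \<le> q x * (p x / q x - 1)"
      using q assms(1)[OF x] by (intro mult_left_mono ln_le_minus_one) auto
    also have "\<dots> = p x - q x" using q by (simp add: field_simps)
    finally show ?thesis .
  qed (use assms(1)[OF x] in simp)
  then have "(\<Sum>x\<in>A. q x * ln (p x) - q x * ln (q x)) \<le> (\<Sum>x\<in>A. p x - q x)"
    by (rule sum_mono)
  then show ?thesis using assms(3) by (simp add: sum_subtractf)
qed

section \<open>Positivity and nonvanishing of the model's factors\<close>

lemma positive_definite_det_nonzero:
  assumes "positive_definite A"
  shows "det A \<noteq> 0"
proof -
  have "v = 0" if "A *v v = 0" for v
    using assms that unfolding positive_definite_def by force
  then show ?thesis
    by (metis invertible_det_nz invertible_left_inverse matrix_left_invertible_ker)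
qed

text \<open>This is the form in which \<open>ln_prod\<close> splits the log likelihood; for a
  Gaussian factor it reduces to a nonzero determinant of the covariance.\<close>

lemma meas_lik_nonzero:
  assumes "valid_model Md" "s \<in> {1..n_sens Md}" "k \<in> {0..n_obj Md}"
  shows "meas_lik Md s y k X \<noteq> 0"
proof (cases "k = 0")
  case True
  have "0 < volume Md s" using assms by (simp add: valid_model_def)
  with True show ?thesis by (simp add: meas_lik_def)
next
  case False
  with assms have "positive_definite (noise_cov Md s k)" by (auto simp: valid_model_def)
  then have "det (noise_cov Md s k) \<noteq> 0" by (rule positive_definite_det_nonzero)
  with False show ?thesis by (simp add: meas_lik_def gaussian_density_def)
qed

lemma assoc_prior1_pos:
  assumes "valid_model Md" "s \<in> {1..n_sens Md}" "k \<in> {0..n_obj Md}"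
  shows "0 < assoc_prior1 Md s k"
  using assms unfolding assoc_prior1_def valid_model_def
  by (intro divide_pos_pos sum_pos) auto

lemma associations_range:
  assumes "\<theta> \<in> associations Md s" "j \<in> {1..n_meas Md s}"
  shows "\<theta> j \<in> {0..n_obj Md}"
  using assms unfolding associations_def by (rule PiE_mem)

lemma q_opt_weight_pos:
  assumes "valid_model Md" "s \<in> {1..n_sens Md}" "k \<in> {0..n_obj Md}"
  shows "0 < q_opt_weight Md Q s l j k"
  using assoc_prior1_pos[OF assms] by (simp add: q_opt_weight_def)

lemma sum_q_opt_weight_pos:
  assumes "valid_model Md" "s \<in> {1..n_sens Md}"
  shows "0 < (\<Sum>k=0..n_obj Md. q_opt_weight Md Q s l j k)"
  using q_opt_weight_pos[OF assms] by (intro sum_pos) auto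

lemma q_opt_pos:
  assumes "valid_model Md" "s \<in> {1..n_sens Md}" "\<theta> \<in> associations Md s"
  shows "0 < q_opt Md Q s l \<theta>"
  unfolding q_opt_def q_opt1_def
  using assms by (intro prod_pos ballI divide_pos_pos q_opt_weight_pos sum_q_opt_weight_pos
      associations_range)

section \<open>The association terms as log normalizer minus relative entropy\<close>

text \<open>The logarithm turns the product over measurements into a sum;
  \<open>finite_expectations\<close> makes each summand integrable, so the integral may be taken
  termwise.\<close>

lemma E_state_ln_likelihood:
  assumes "valid_model Md" "finite_expectations Md Q" "s \<in> {1..n_sens Md}" "l \<in> lambda_dom Q"
    and \<theta>: "\<theta> \<in> associations Md s"
  shows "E_state Md Q l (\<lambda>X. ln (likelihood Md s \<theta> X))
           = (\<Sum>j=1..n_meas Md s. E_state Md Q l (\<lambda>X. ln (meas_lik Md s (meas Md s j) (\<theta> j) X)))"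
proof -
  have "ln (likelihood Md s \<theta> X) = (\<Sum>j=1..n_meas Md s. ln (meas_lik Md s (meas Md s j) (\<theta> j) X))" for X
    unfolding likelihood_def
    using meas_lik_nonzero[OF assms(1,3) associations_range[OF \<theta>]] by (intro ln_prod) auto
  then have "E_state Md Q l (\<lambda>X. ln (likelihood Md s \<theta> X)) =
      (\<integral>X. (\<Sum>j=1..n_meas Md s. q_state Md Q l X * ln (meas_lik Md s (meas Md s j) (\<theta> j) X)) \<partial>state_space Md)"
    by (simp add: E_state_def sum_distrib_left)
  also have "\<dots> = (\<Sum>j=1..n_meas Md s. \<integral>X. q_state Md Q l X * ln (meas_lik Md s (meas Md s j) (\<theta> j) X) \<partial>state_space Md)"
    using assms(2-4) associations_range[OF \<theta>]
    by (intro Bochner_Integration.integral_sum) (auto simp: finite_expectations_def)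
  finally show ?thesis by (simp add: E_state_def)
qed

text \<open>The subtracted normalizer does not depend on \<theta>. Hence expected log likelihood
  plus log prior can be replaced by \<open>ln (q_opt Md Q s l \<theta>)\<close> up to a
  constant.\<close>

lemma ln_q_opt:
  assumes "valid_model Md" "finite_expectations Md Q" "s \<in> {1..n_sens Md}" "l \<in> lambda_dom Q"
    and \<theta>: "\<theta> \<in> associations Md s"
  shows "ln (q_opt Md Q s l \<theta>) =
    E_state Md Q l (\<lambda>X. ln (likelihood Md s \<theta> X)) + ln (assoc_prior Md s \<theta>)
      - (\<Sum>j=1..n_meas Md s. ln (\<Sum>k=0..n_obj Md. q_opt_weight Md Q s l j k))"
proof -
  note pos = assoc_prior1_pos[OF assms(1,3) associations_range[OF \<theta>]]
    q_opt_weight_pos[OF assms(1,3) associations_range[OF \<theta>], of _ Q l]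
    sum_q_opt_weight_pos[OF assms(1,3), of Q l]
  note nonzero = pos[THEN less_imp_neq, THEN not_sym]
  have "ln (q_opt Md Q s l \<theta>) = (\<Sum>j=1..n_meas Md s. ln (q_opt1 Md Q s l j (\<theta> j)))"
    unfolding q_opt_def q_opt1_def
    using nonzero(2,3) by (intro ln_prod) auto
  also have "\<dots> = (\<Sum>j=1..n_meas Md s. ln (assoc_prior1 Md s (\<theta> j))
      + E_state Md Q l (\<lambda>X. ln (meas_lik Md s (meas Md s j) (\<theta> j) X))
      - ln (\<Sum>k=0..n_obj Md. q_opt_weight Md Q s l j k))"
  proof (rule sum.cong[OF refl])
    fix j assume j: "j \<in> {1..n_meas Md s}"
    have "ln (q_opt1 Md Q s l j (\<theta> j)) = ln (q_opt_weight Md Q s l j (\<theta> j))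
        - ln (\<Sum>k=0..n_obj Md. q_opt_weight Md Q s l j k)"
      unfolding q_opt1_def using pos(2)[OF j] pos(3) by (rule ln_divide_pos)
    moreover have "ln (q_opt_weight Md Q s l j (\<theta> j)) = ln (assoc_prior1 Md s (\<theta> j))
      + E_state Md Q l (\<lambda>X. ln (meas_lik Md s (meas Md s j) (\<theta> j) X))"
      unfolding q_opt_weight_def using pos(1)[OF j] by (simp add: ln_mult)
    ultimately show "ln (q_opt1 Md Q s l j (\<theta> j)) = ln (assoc_prior1 Md s (\<theta> j))
      + E_state Md Q l (\<lambda>X. ln (meas_lik Md s (meas Md s j) (\<theta> j) X))
      - ln (\<Sum>k=0..n_obj Md. q_opt_weight Md Q s l j k)" by simp
  qed
  also have "\<dots> = (\<Sum>j=1..n_meas Md s. ln (assoc_prior1 Md s (\<theta> j)))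
      + E_state Md Q l (\<lambda>X. ln (likelihood Md s \<theta> X))
      - (\<Sum>j=1..n_meas Md s. ln (\<Sum>k=0..n_obj Md. q_opt_weight Md Q s l j k))"
    using E_state_ln_likelihood[OF assms] by (simp add: sum.distrib sum_subtractf)
  also have "(\<Sum>j=1..n_meas Md s. ln (assoc_prior1 Md s (\<theta> j))) = ln (assoc_prior Md s \<theta>)"
    unfolding assoc_prior_def using nonzero(1) by (intro ln_prod[symmetric]) auto
  finally show ?thesis by simp
qed

text \<open>The bracket on the right is minus the relative entropy of \<open>q\<close> with respect
  to \<open>q_opt\<close>, and \<open>?c\<close> is free of \<open>q\<close>. The identity is stated
  for arbitrary \<open>q\<close> of total mass one so that it serves both bounds.\<close>

lemma association_terms_eq:
  assumes "valid_model Md" "finite_expectations Md Q" "s \<in> {1..n_sens Md}" "l \<in> lambda_dom Q"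
    and "(\<Sum>\<theta>\<in>associations Md s. q \<theta>) = 1"
  shows "E_joint Md Q s l q (\<lambda>\<theta> X. ln (likelihood Md s \<theta> X))
           + E_assoc Md s q (\<lambda>\<theta>. ln (assoc_prior Md s \<theta> / q \<theta>))
         = (\<Sum>j=1..n_meas Md s. ln (\<Sum>k=0..n_obj Md. q_opt_weight Md Q s l j k))
           + ((\<Sum>\<theta>\<in>associations Md s. q \<theta> * ln (q_opt Md Q s l \<theta>))
              - (\<Sum>\<theta>\<in>associations Md s. q \<theta> * ln (q \<theta>)))"
    (is "_ = ?c + _")
proof -
  have "q \<theta> * E_state Md Q l (\<lambda>X. ln (likelihood Md s \<theta> X)) + q \<theta> * ln (assoc_prior Md s \<theta> / q \<theta>)
      = q \<theta> * ?c + (q \<theta> * ln (q_opt Md Q s l \<theta>) - q \<theta> * ln (q \<theta>))"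
    if \<theta>: "\<theta> \<in> associations Md s" for \<theta>
  \<comment> \<open>If \<open>q \<theta> = 0\<close>, every term carries this factor and vanishes;
    otherwise the logarithm of the quotient splits.\<close>
  proof (cases "q \<theta> = 0")
    case False
    have "assoc_prior Md s \<theta> > 0"
      unfolding assoc_prior_def
      using assoc_prior1_pos[OF assms(1,3) associations_range[OF \<theta>]] by (intro prod_pos) auto
    with False have "ln (assoc_prior Md s \<theta> / q \<theta>) = ln (assoc_prior Md s \<theta>) - ln (q \<theta>)"
      by (simp add: ln_div)
    then show ?thesis
      unfolding ln_q_opt[OF assms(1-4) \<theta>] by (simp only:) (simp add: algebra_simps)
  qed simp
  then have "E_joint Md Q s l q (\<lambda>\<theta> X. ln (likelihood Md s \<theta> X))
           + E_assoc Md s q (\<lambda>\<theta>. ln (assoc_prior Md s \<theta> / q \<theta>))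
     = (\<Sum>\<theta>\<in>associations Md s. q \<theta> * ?c + (q \<theta> * ln (q_opt Md Q s l \<theta>) - q \<theta> * ln (q \<theta>)))"
    unfolding E_joint_def E_assoc_def sum.distrib[symmetric] by (intro sum.cong) auto
  also have "\<dots> = ?c + ((\<Sum>\<theta>\<in>associations Md s. q \<theta> * ln (q_opt Md Q s l \<theta>))
              - (\<Sum>\<theta>\<in>associations Md s. q \<theta> * ln (q \<theta>)))"
    using assms(5) by (simp add: sum.distrib sum_subtractf flip: sum_distrib_right)
  finally show ?thesis .
qed

text \<open>Distributivity turns the sum over association vectors into a product, over measurements,
  of sums normalized to one.\<close>

lemma sum_q_opt:
  assumes "valid_model Md" "s \<in> {1..n_sens Md}"
  shows "(\<Sum>\<theta>\<in>associations Md s. q_opt Md Q s l \<theta>) = 1"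
proof -
  have "(\<Sum>\<theta>\<in>associations Md s. q_opt Md Q s l \<theta>)
      = (\<Prod>j=1..n_meas Md s. \<Sum>k=0..n_obj Md. q_opt1 Md Q s l j k)"
    unfolding associations_def q_opt_def by (rule prod_sum_PiE[symmetric]) auto
  also have "\<dots> = 1"
  proof (rule prod.neutral, rule ballI)
    fix j
    show "(\<Sum>k=0..n_obj Md. q_opt1 Md Q s l j k) = 1"
      using sum_q_opt_weight_pos[OF assms, of Q l j]
      by (simp add: q_opt1_def flip: sum_divide_distrib)
  qed
  finally show ?thesis .
qed

section \<open>Comparison of the two bounds and of their Hessians\<close>

text \<open>The state term and the log normalizer are common to both bounds. The gap is the relative
  entropy of \<open>assoc_pmf\<close> with respect to \<open>q_opt\<close>, nonnegative by
  \<open>Gibbs_inequality\<close>.\<close>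

lemma local_elbo_le_local_lm_elbo:
  assumes "valid_model Md" "valid_family Md Q" "finite_expectations Md Q"
    and "s \<in> {1..n_sens Md}" "l \<in> lambda_dom Q" "\<rho> \<in> rho_dom Q s"
  shows "local_elbo Md Q s l \<rho> \<le> local_lm_elbo Md Q s l"
proof -
  have q: "\<And>\<theta>. \<theta> \<in> associations Md s \<Longrightarrow> 0 \<le> assoc_pmf Q s \<rho> \<theta>"
    "(\<Sum>\<theta>\<in>associations Md s. assoc_pmf Q s \<rho> \<theta>) = 1"
    using assms(2,4,6) by (auto simp: valid_family_def)
  have "(\<Sum>\<theta>\<in>associations Md s. assoc_pmf Q s \<rho> \<theta> * ln (q_opt Md Q s l \<theta>))
      \<le> (\<Sum>\<theta>\<in>associations Md s. assoc_pmf Q s \<rho> \<theta> * ln (assoc_pmf Q s \<rho> \<theta>))"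
    using q sum_q_opt[OF assms(1,4)] q_opt_pos[OF assms(1,4)] by (intro Gibbs_inequality) auto
  then show ?thesis
    unfolding local_elbo_def local_lm_elbo_def
      association_terms_eq[OF assms(1,3,4,5) q(2)]
      association_terms_eq[OF assms(1,3,4,5) sum_q_opt[OF assms(1,4)]]
    by simp
qed

text \<open>The bounds see an association distribution only through its values on
  \<open>associations Md s\<close>, where the two agree.\<close>

lemma local_elbo_opt_parameter:
  assumes "is_opt_parameter Md Q s l \<rho>"
  shows "local_elbo Md Q s l \<rho> = local_lm_elbo Md Q s l"
  using assms
  by (simp add: is_opt_parameter_def local_elbo_def local_lm_elbo_def E_joint_def E_assoc_def)

theorem mainTheorem7:
  fixes Md :: "('d::finite, 'm::finite) tracking_model"
    and Q :: "('d, 'p::finite) variational_family"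
    and s :: nat
    and \<rho>star :: "nat \<Rightarrow> real ^ 'p \<Rightarrow> nat \<Rightarrow> real"
    and lam :: "real ^ 'p"
  assumes "valid_model Md"
    and "valid_family Md Q"
    and "finite_expectations Md Q"
    and "\<And>t l. t \<in> {1..n_sens Md} \<Longrightarrow> l \<in> lambda_dom Q \<Longrightarrow> is_opt_parameter Md Q t l (\<rho>star t l)"
    and "s \<in> {1..n_sens Md}"
    and "lam \<in> lambda_dom Q"
    and "twice_differentiable_at (local_lm_elbo Md Q s) lam"
    and "twice_differentiable_at (\<lambda>l. local_elbo Md Q s l (\<rho>star s lam)) lam"
  shows "\<exists>P. positive_semidefinite P \<and>
           hessian (local_lm_elbo Md Q s) lam
             = hessian (\<lambda>l. local_elbo Md Q s l (\<rho>star s lam)) lam + P"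
proof -
  let ?g = "\<lambda>l. local_lm_elbo Md Q s l - local_elbo Md Q s l (\<rho>star s lam)"
  have opt: "is_opt_parameter Md Q s lam (\<rho>star s lam)"
    using assms(4-6) by blast
  then have "\<rho>star s lam \<in> rho_dom Q s" by (simp add: is_opt_parameter_def)
  then have "?g lam \<le> ?g l" if "l \<in> lambda_dom Q" for l
    using local_elbo_le_local_lm_elbo[OF assms(1-3,5) that] local_elbo_opt_parameter[OF opt] by simp
  \<comment> \<open>Openness upgrades the inequality on the parameter domain to one on a
    neighbourhood of \<open>lam\<close>.\<close>
  moreover have "open (lambda_dom Q)" using assms(2) by (simp add: valid_family_def)
  ultimately have "\<forall>\<^sub>F l in nhds lam. ?g lam \<le> ?g l"
    using assms(6) unfolding eventually_nhds by blast
  with twice_differentiable_at_diff[OF assms(7,8)] have "positive_semidefinite (hessian ?g lam)"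
    by (rule positive_semidefinite_hessian_local_min)
  \<comment> \<open>The witness for \<open>P\<close> is \<open>hessian ?g lam\<close>, which equals
    the difference of the two Hessians.\<close>
  with hessian_diff[OF assms(7,8)] show ?thesis
    by (metis add.commute diff_add_cancel)
qed

end
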